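(* Let $k\leq 12$ and let $m$ be a positive integer all of whose prime factors are larger than $k!$. Then any subset $S$ of $D_{2m}\setminus\{\mathrm{id}\}$ with $|S|=k$ is sequenceable.
   Context: $D_{2m}$ is the dihedral group of order $2m$, i.e. $\mathbb{Z}_m\rtimes\mathbb{Z}_2$ with product $(x,a)(y,b)=(x+(-1)^a y,\,a+b)$. Let $G$ be a group and $S\subseteq G\setminus\{\mathrm{id}_G\}$ a finite subset with $|S|=k$. For an ordering $x_1,\dots,x_k$ of the elements of $S$ (each used exactly once), the partial sums are $s_0=\mathrm{id}_G$ and $s_j=x_1x_2\cdots x_j$ for $0<j\le k$. The ordering is a linear sequencing if $s_0,\dots,s_k$ are all different, and a cyclic sequencing if they are all different with the single exception $s_0=s_k=\mathrm{id}_G$. $S$ is sequenceable if it has a linear or a cyclic sequencing. *)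

theory Defs
  imports "HOL-Algebra.Elementary_Groups" "HOL-Computational_Algebra.Primes"
begin

text \<open>
  The argument \<open>m\<close> is half of the order, i.e. this is the group \<open>D\<^sub>2\<^sub>m\<close>. Elements are
  represented by pairs of reduced residues. For \<open>m = 0\<close> one gets the infinite dihedral group,
  because \<open>integer_mod_group 0\<close> is the additive group of the integers.
\<close>

definition dihedral_group :: "nat \<Rightarrow> (int \<times> int) monoid" where
  "dihedral_group m =
    \<lparr>carrier = carrier (integer_mod_group m) \<times> carrier (integer_mod_group 2),
     monoid.mult = (\<lambda>(x, a) (y, b). ((x + (-1) ^ nat a * y) mod int m, (a + b) mod 2)),
     one = (0, 0)\<rparr>"

lemma group_dihedral_group: "group (dihedral_group m)"
proof -
  have two: "a = 0 \<or> a = 1" if "0 \<le> a" "a < 2" for a :: int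
    using that by auto
  show ?thesis
  proof (rule groupI)
    fix u v w
    assume "u \<in> carrier (dihedral_group m)" "v \<in> carrier (dihedral_group m)"
      "w \<in> carrier (dihedral_group m)"
    moreover obtain x a y b z c where uvw: "u = (x, a)" "v = (y, b)" "w = (z, c)"
      by (metis surj_pair)
    ultimately have "a = 0 \<or> a = 1" "b = 0 \<or> b = 1" "c = 0 \<or> c = 1"
      using two by (auto simp: dihedral_group_def carrier_integer_mod_group)
    moreover have "((x + s * y) mod int m + s * t * z) mod int m =
        (x + s * ((y + t * z) mod int m)) mod int m" for s t :: int
    proof -
      have "(x + s * ((y + t * z) mod int m)) mod int m = (x + s * (y + t * z)) mod int m"
        by (metis mod_add_right_eq mod_mult_right_eq)
      also have "x + s * (y + t * z) = (x + s * y) + s * t * z"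
        by (simp add: algebra_simps)
      finally show ?thesis
        by (simp add: mod_add_left_eq)
    qed
    from this[of 1 1] this[of 1 "-1"] this[of "-1" 1] this[of "-1" "-1"]
    show "u \<otimes>\<^bsub>dihedral_group m\<^esub> v \<otimes>\<^bsub>dihedral_group m\<^esub> w =
        u \<otimes>\<^bsub>dihedral_group m\<^esub> (v \<otimes>\<^bsub>dihedral_group m\<^esub> w)"
      using calculation by (elim disjE) (simp_all add: uvw dihedral_group_def)
  next
    fix u assume u: "u \<in> carrier (dihedral_group m)"
    obtain x a where xa: "u = (x, a)" by (cases u)
    define v where "v = (if a = 0 then ((- x) mod int m, 0) else u)"
    show "\<exists>v \<in> carrier (dihedral_group m). v \<otimes>\<^bsub>dihedral_group m\<^esub> u = \<one>\<^bsub>dihedral_group m\<^esub>"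
    proof
      show "v \<in> carrier (dihedral_group m)"
        using u by (auto simp: v_def xa dihedral_group_def carrier_integer_mod_group)
      show "v \<otimes>\<^bsub>dihedral_group m\<^esub> u = \<one>\<^bsub>dihedral_group m\<^esub>"
        using u by (auto simp: v_def xa dihedral_group_def carrier_integer_mod_group mod_simps
            dest!: two split: if_splits)
    qed
  qed (auto simp: dihedral_group_def carrier_integer_mod_group split: if_splits)
qed

lemma order_dihedral_group: "order (dihedral_group m) = 2 * m"
  by (simp add: order_def dihedral_group_def carrier_integer_mod_group card_cartesian_product)

text \<open>The list \<open>xs\<close> is the ordering, so \<open>x\<^sub>i\<close> is \<open>xs ! (i - 1)\<close>.\<close>

definition ordering_of :: "'a set \<Rightarrow> 'a list \<Rightarrow> bool" where
  "ordering_of S xs \<longleftrightarrow> distinct xs \<and> set xs = S"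

definition partial_sum :: "('a, 'b) monoid_scheme \<Rightarrow> 'a list \<Rightarrow> nat \<Rightarrow> 'a" where
  "partial_sum G xs j = foldl (\<otimes>\<^bsub>G\<^esub>) \<one>\<^bsub>G\<^esub> (take j xs)"

definition linear_sequencing :: "('a, 'b) monoid_scheme \<Rightarrow> 'a set \<Rightarrow> 'a list \<Rightarrow> bool" where
  "linear_sequencing G S xs \<longleftrightarrow> ordering_of S xs \<and>
    (\<forall>i j. i < j \<and> j \<le> length xs \<longrightarrow> partial_sum G xs i \<noteq> partial_sum G xs j)"

definition cyclic_sequencing :: "('a, 'b) monoid_scheme \<Rightarrow> 'a set \<Rightarrow> 'a list \<Rightarrow> bool" where
  "cyclic_sequencing G S xs \<longleftrightarrow> ordering_of S xs \<and>
    partial_sum G xs 0 = \<one>\<^bsub>G\<^esub> \<and> partial_sum G xs (length xs) = \<one>\<^bsub>G\<^esub> \<and>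
    (\<forall>i j. i < j \<and> j \<le> length xs \<and> (i, j) \<noteq> (0, length xs) \<longrightarrow>
      partial_sum G xs i \<noteq> partial_sum G xs j)"

definition sequenceable :: "('a, 'b) monoid_scheme \<Rightarrow> 'a set \<Rightarrow> bool" where
  "sequenceable G S \<longleftrightarrow> (\<exists>xs. linear_sequencing G S xs \<or> cyclic_sequencing G S xs)"

end

theory Submission
  imports Defs "Jordan_Normal_Form.Determinant" "HOL-Library.Sublist"
begin

text \<open>
  Two partial products differ iff the segment of the ordering between them does not multiply to
  the identity. In a dihedral group such a product is an alternating sum:
  the rotational coordinates of the factors are added, and the sign flips after every
  reflection; it is trivial iff this sum vanishes modulo \<open>m\<close> and the number of reflections is even.
  So only linear forms with coefficients in \<open>{-1, 0, 1}\<close> in the coordinates of \<open>S\<close> matter.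

  \<^emph>\<open>Rectification\<close> (\<open>rectification\<close>). Linear dependence among such forms is witnessed by
  determinants of size at most \<open>k\<close> with entries in \<open>{-1, 0, 1}\<close>. These have absolute value at most
  \<open>k!\<close>, so the nonzero ones are invertible modulo \<open>m\<close>. Hence the coordinates can be replaced by
  integers \<open>v\<close> on which exactly the same forms vanish, now over the integers. This reduces
  the problem to the infinite dihedral group, where the order of the integers is available.

  \<^emph>\<open>Rotations only\<close> (\<open>exists_ordering_no_zero_segment\<close>). Arrange the positive values before the
  negative ones, so that the partial sums go up and then down. If the total is nonzero, say
  positive, then all later partial sums lie above the starting point \<open>0\<close>. The first element can
  therefore be fixed freely, and it is chosen so that the remaining total is nonzero again. A total of
  zero gives a cyclic sequencing in the same way.

  \<^emph>\<open>At least one reflection\<close> (\<open>exists_well_signed_ordering\<close>). Follow the partial products, which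
  are pairs of a position and an orientation. A rotation by \<open>r\<close> moves the position by \<open>r\<close> or
  \<open>-r\<close>, depending on the orientation. Using positive rotations in one orientation and negative ones
  in the other, every rotation moves upwards. Let \<open>\<tau>/2\<close> be a median of the values of the reflections,
  and use reflections above and below it alternately. Then the position, lowered by \<open>\<tau>/2\<close> whenever
  the orientation is reversed, increases with every step of the walk, and no partial product repeats.
\<close>

section \<open>Minors of systems of integer linear forms\<close>


definition minor :: "('a \<Rightarrow> int) list \<Rightarrow> 'a list \<Rightarrow> int" where
  "minor bs js = det (mat (length js) (length js) (\<lambda>(a, b). (bs ! a) (js ! b)))"

text \<open>The Leibniz formula has one term of absolute value at most one for each permutation.\<close>

lemma abs_minor_le_fact:
  assumes "length bs = length js"
    and "\<And>b j. b \<in> set bs \<Longrightarrow> j \<in> set js \<Longrightarrow> \<bar>b j\<bar> \<le> 1"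
  shows "\<bar>minor bs js\<bar> \<le> fact (length js)"
proof -
  let ?n = "length js"
  let ?P = "{p. p permutes {0..<?n}}"
  have "\<bar>minor bs js\<bar> = \<bar>\<Sum>p\<in>?P. signof p * (\<Prod>i = 0..<?n. (bs ! i) (js ! p i))\<bar>"
    unfolding minor_def
    by (subst det_def'[of _ ?n]) (auto intro!: arg_cong[of _ _ abs] sum.cong prod.cong
        dest: permutes_in_image[THEN iffD2])
  also have "\<dots> \<le> (\<Sum>p\<in>?P. \<bar>signof p * (\<Prod>i = 0..<?n. (bs ! i) (js ! p i))\<bar>)"
    by (rule sum_abs)
  also have "\<dots> \<le> (\<Sum>p\<in>?P. 1)"
  proof (rule sum_mono)
    fix p assume p: "p \<in> ?P"
    have "\<bar>\<Prod>i = 0..<?n. (bs ! i) (js ! p i)\<bar> \<le> 1"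
      unfolding abs_prod
    proof (rule prod_le_1)
      fix i assume i: "i \<in> {0..<?n}"
      then have "p i < ?n" using p permutes_in_image[of p "{0..<?n}" i] by auto
      then show "0 \<le> \<bar>(bs ! i) (js ! p i)\<bar> \<and> \<bar>(bs ! i) (js ! p i)\<bar> \<le> 1"
        using assms i by auto
    qed
    then show "\<bar>signof p * (\<Prod>i = 0..<?n. (bs ! i) (js ! p i))\<bar> \<le> (1 :: int)"
      by (auto simp: abs_mult sign_def)
  qed
  also have "\<dots> = fact ?n"
    by (simp add: card_permutations[of "{0..<?n}" ?n])
  finally show ?thesis .
qed

lemma minor_nonzero_distinct:
  assumes "minor bs js \<noteq> 0"
  shows "distinct js"
proof (rule ccontr)
  assume "\<not> distinct js"
  then obtain a b where "a < length js" "b < length js" "a \<noteq> b" "js ! a = js ! b"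
    by (auto simp: distinct_conv_nth)
  then have "minor bs js = 0"
    unfolding minor_def by (intro det_identical_columns[of _ "length js" a b]) (auto simp: col_def)
  with assms show False ..
qed

text \<open>
  Bordering a minor by a row \<open>c\<close> and a column \<open>j\<close> can be read in two ways. Expanded along the new
  column, whose cofactors do not depend on \<open>j\<close>, it expresses a multiple of \<open>c\<close> by the rows \<open>bs\<close>
  as soon as it vanishes for all \<open>j\<close>. Expanded along the new row, whose cofactors do not depend on
  \<open>c\<close>, it is a linear functional of \<open>c\<close>.
\<close>

lemma minor_expand_last_column:
  assumes "length bs = length js"
  obtains \<gamma> where "\<And>j. minor (bs @ [c]) (js @ [j]) =
      minor bs js * c j + (\<Sum>a<length bs. \<gamma> a * (bs ! a) j)"
proof -
  let ?r = "length js"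
  define M where "M j = mat (Suc ?r) (Suc ?r) (\<lambda>(a, b). ((bs @ [c]) ! a) ((js @ [j]) ! b))" for j
  define \<gamma> where "\<gamma> a = (-1) ^ (a + ?r) *
      det (mat ?r ?r (\<lambda>(i, b). ((bs @ [c]) ! insert_index a i) (js ! b)))" for a
  have cof: "cofactor (M j) a ?r = \<gamma> a" for a j
    unfolding cofactor_def \<gamma>_def M_def
    by (rule arg_cong[where f = "\<lambda>A. _ * det A"], rule eq_matI)
      (auto simp: mat_delete_def insert_index_def nth_append)
  have "\<gamma> ?r = minor bs js"
  proof -
    have "mat ?r ?r (\<lambda>(i, b). ((bs @ [c]) ! insert_index ?r i) (js ! b)) =
        mat ?r ?r (\<lambda>(a, b). (bs ! a) (js ! b))"
      by (rule eq_matI) (auto simp: insert_index_def nth_append assms)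
    then show ?thesis
      by (simp add: \<gamma>_def minor_def flip: mult_2)
  qed
  moreover have "minor (bs @ [c]) (js @ [j]) =
      (\<Sum>a<Suc ?r. M j $$ (a, ?r) * cofactor (M j) a ?r)" for j
    unfolding minor_def
    by (subst laplace_expansion_column[of _ "Suc ?r" ?r]) (auto simp: M_def)
  ultimately have "minor (bs @ [c]) (js @ [j]) =
      minor bs js * c j + (\<Sum>a<length bs. \<gamma> a * (bs ! a) j)" for j
    by (auto simp: cof, auto simp: M_def assms nth_append mult.commute intro!: sum.cong)
  then show ?thesis by (rule that)
qed

lemma minor_expand_last_row:
  assumes "length bs = length js"
  obtains \<gamma> where "\<And>c. minor (bs @ [c]) (js @ [j]) =
      minor bs js * c j + (\<Sum>a<length js. \<gamma> a * c (js ! a))"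
proof -
  let ?r = "length js"
  define M where "M c = mat (Suc ?r) (Suc ?r) (\<lambda>(a, b). ((bs @ [c]) ! a) ((js @ [j]) ! b))" for c
  define \<gamma> where "\<gamma> b = (-1) ^ (?r + b) *
      det (mat ?r ?r (\<lambda>(a, i). (bs ! a) ((js @ [j]) ! insert_index b i)))" for b
  have cof: "cofactor (M c) ?r b = \<gamma> b" for b c
    unfolding cofactor_def \<gamma>_def M_def
    by (rule arg_cong[where f = "\<lambda>A. _ * det A"], rule eq_matI)
      (auto simp: mat_delete_def insert_index_def nth_append assms)
  have "\<gamma> ?r = minor bs js"
  proof -
    have "mat ?r ?r (\<lambda>(a, i). (bs ! a) ((js @ [j]) ! insert_index ?r i)) =
        mat ?r ?r (\<lambda>(a, b). (bs ! a) (js ! b))"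
      by (rule eq_matI) (auto simp: insert_index_def nth_append assms)
    then show ?thesis
      by (simp add: \<gamma>_def minor_def flip: mult_2)
  qed
  moreover have "minor (bs @ [c]) (js @ [j]) =
      (\<Sum>b<Suc ?r. M c $$ (?r, b) * cofactor (M c) ?r b)" for c
    unfolding minor_def
    by (subst laplace_expansion_row[of _ "Suc ?r" ?r]) (auto simp: M_def)
  ultimately have "minor (bs @ [c]) (js @ [j]) =
      minor bs js * c j + (\<Sum>a<length js. \<gamma> a * c (js ! a))" for c
    by (auto simp: cof, auto simp: M_def assms nth_append mult.commute intro!: sum.cong)
  then show ?thesis by (rule that)
qed

lemma bordered_minor_functional:
  assumes "finite S" "length bs = length js" "set js \<subseteq> S" "j \<in> S"
  obtains w where "\<And>c. minor (bs @ [c]) (js @ [j]) = (\<Sum>s\<in>S. c s * w s)"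
proof -
  obtain \<gamma> where \<gamma>: "\<And>c. minor (bs @ [c]) (js @ [j]) =
      minor bs js * c j + (\<Sum>a<length js. \<gamma> a * c (js ! a))"
    using minor_expand_last_row[OF assms(2)] by metis
  define w where "w s = (if s = j then minor bs js else 0) +
      (\<Sum>a<length js. if s = js ! a then \<gamma> a else 0)" for s
  have "(\<Sum>s\<in>S. c s * w s) = minor (bs @ [c]) (js @ [j])" for c
  proof -
    have "(\<Sum>s\<in>S. c s * w s) = (\<Sum>s\<in>S. if s = j then minor bs js * c j else 0) +
        (\<Sum>s\<in>S. \<Sum>a<length js. if s = js ! a then \<gamma> a * c (js ! a) else 0)"
      unfolding sum.distrib[symmetric] w_def distrib_left sum_distrib_left
      by (intro sum.cong refl arg_cong2[where f = "(+)"]) auto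
    also have "(\<Sum>s\<in>S. \<Sum>a<length js. if s = js ! a then \<gamma> a * c (js ! a) else 0) =
        (\<Sum>a<length js. \<gamma> a * c (js ! a))"
      using assms by (subst sum.swap) (intro sum.cong refl,
        use subsetD[OF assms(3) nth_mem] in \<open>simp add: sum.delta\<close>)
    finally show ?thesis
      using assms by (simp add: \<gamma> sum.delta)
  qed
  then show ?thesis using that by metis
qed

section \<open>Rectification of small sets of residues\<close>

text \<open>
  The coefficients are chosen one after the other. A vector with a nonzero entry at the new coordinate
  rules out at most one integer as the new coefficient, and there are only finitely many vectors;
  the others are taken care of by the earlier coefficients.
\<close>

lemma generic_combination:
  fixes D :: "('a \<Rightarrow> int) set"
  assumes "finite S" "finite D"
  obtains u where "\<And>f. f \<in> D \<Longrightarrow> (\<Sum>j\<in>S. u j * f j) = 0 \<Longrightarrow> (\<forall>j\<in>S. f j = 0)"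
proof -
  have "\<exists>u. \<forall>f\<in>D. (\<Sum>j\<in>S. u j * f j) = 0 \<longrightarrow> (\<forall>j\<in>S. f j = 0)"
    using assms(1)
  proof (induction S rule: finite_induct)
    case (insert i S)
    then obtain u where u: "\<forall>f\<in>D. (\<Sum>j\<in>S. u j * f j) = 0 \<longrightarrow> (\<forall>j\<in>S. f j = 0)" by auto
    let ?B = "(\<lambda>f. - (\<Sum>j\<in>S. u j * f j) div f i) ` D"
    obtain t where t: "t \<notin> ?B"
      using assms(2) infinite_UNIV_int ex_new_if_finite by blast
    have "\<forall>f\<in>D. (\<Sum>j\<in>insert i S. (u(i := t)) j * f j) = 0 \<longrightarrow> (\<forall>j\<in>insert i S. f j = 0)"
    proof (rule ballI, rule impI)
      fix f assume f: "f \<in> D" "(\<Sum>j\<in>insert i S. (u(i := t)) j * f j) = 0"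
      have "(\<Sum>j\<in>S. (u(i := t)) j * f j) = (\<Sum>j\<in>S. u j * f j)"
        using insert by (intro sum.cong) auto
      with f have eq: "t * f i = - (\<Sum>j\<in>S. u j * f j)"
        using insert by simp
      have "f i = 0"
      proof (rule ccontr)
        assume "f i \<noteq> 0"
        then have "t = - (\<Sum>j\<in>S. u j * f j) div f i"
          unfolding eq[symmetric] by simp
        with t f(1) show False by blast
      qed
      with eq u f(1) show "\<forall>j\<in>insert i S. f j = 0" by simp
    qed
    then show ?case by blast
  qed simp
  then show ?thesis using that by blast
qed

lemma coprime_of_abs_le_fact:
  fixes d :: int and m k :: nat
  assumes "m > 0" "\<And>p. prime p \<Longrightarrow> p dvd m \<Longrightarrow> p > fact k" "d \<noteq> 0" "\<bar>d\<bar> \<le> fact k"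
  shows "coprime d (int m)"
proof -
  have "coprime (nat \<bar>d\<bar>) m"
  proof (rule ccontr)
    assume "\<not> coprime (nat \<bar>d\<bar>) m"
    then obtain p where p: "prime p" "p dvd nat \<bar>d\<bar>" "p dvd m"
      by (metis coprime_iff_gcd_eq_1 gcd_greatest_iff prime_factor_nat)
    then have "p \<le> nat \<bar>d\<bar>" using assms(3) by (intro dvd_imp_le) auto
    moreover have "nat \<bar>d\<bar> \<le> fact k"
      using assms(4) by (simp add: nat_le_iff)
    ultimately show False using assms(2)[OF p(1,3)] by simp
  qed
  then show ?thesis
    by (metis coprime_abs_left_iff coprime_int_iff int_nat_eq abs_ge_zero)
qed

text \<open>
  Let \<open>C\<close> be the set of forms with small coefficients that vanish at \<open>x\<close> modulo \<open>m\<close>, and take a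
  nonzero minor of maximal size with rows in \<open>C\<close>. By maximality, all bordered minors of a member
  of \<open>C\<close> vanish. Conversely, if all bordered minors of \<open>c\<close> vanish, then a multiple of \<open>c\<close> by an
  integer coprime to \<open>m\<close> is an integer combination of members of \<open>C\<close>, and so \<open>c\<close> is itself in \<open>C\<close>.
  Thus \<open>C\<close> is cut out by finitely many integer functionals, and a generic combination of
  them vanishes on no further small form.
\<close>

lemma rectification:
  fixes x :: "'a \<Rightarrow> int" and m :: nat
  assumes S: "finite S"
    and m: "m > 0" "\<And>p. prime p \<Longrightarrow> p dvd m \<Longrightarrow> p > fact (card S)"
  obtains v :: "'a \<Rightarrow> int" where
    "\<And>c. (\<And>s. s \<in> S \<Longrightarrow> \<bar>c s\<bar> \<le> 1) \<Longrightarrow>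
      (\<Sum>s\<in>S. c s * v s) = 0 \<longleftrightarrow> int m dvd (\<Sum>s\<in>S. c s * x s)"
proof -
  define Q where "Q = S \<rightarrow>\<^sub>E {-1..1 :: int}"
  have "finite Q" unfolding Q_def using S by (intro finite_PiE) auto
  define C where "C = {c \<in> Q. int m dvd (\<Sum>s\<in>S. c s * x s)}"
  define P where "P r \<longleftrightarrow> (\<exists>bs js. length bs = r \<and> length js = r \<and> set bs \<subseteq> C \<and> set js \<subseteq> S \<and>
      minor bs js \<noteq> 0)" for r
  have small: "\<bar>c s\<bar> \<le> 1" if "c \<in> C" "s \<in> S" for c s
    using that by (auto simp: C_def Q_def PiE_iff abs_le_iff)
  have "P 0" unfolding P_def by (intro exI[of _ "[]"]) (simp add: minor_def)
  have bound: "r \<le> card S" if "P r" for r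
    using that unfolding P_def using minor_nonzero_distinct distinct_card S card_mono by metis
  define r where "r = (GREATEST r. P r)"
  have "P r" unfolding r_def using \<open>P 0\<close> bound by (rule GreatestI_nat)
  have notP: "\<not> P (Suc r)"
    using Greatest_le_nat[of P "Suc r" "card S"] bound unfolding r_def by fastforce
  from \<open>P r\<close> obtain bs js where bj: "length bs = r" "length js = r" "set bs \<subseteq> C" "set js \<subseteq> S"
    and nz: "minor bs js \<noteq> 0" unfolding P_def by blast
  define \<Delta> where "\<Delta> c j = minor (bs @ [c]) (js @ [j])" for c j
  have cop: "coprime (minor bs js) (int m)"
  proof (rule coprime_of_abs_le_fact[OF m nz])
    have "\<bar>minor bs js\<bar> \<le> fact (length js)"
      using bj small by (intro abs_minor_le_fact) auto
    also have "\<dots> \<le> fact (card S)"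
      using bound[OF \<open>P r\<close>] bj by (intro fact_mono) auto
    finally show "\<bar>minor bs js\<bar> \<le> fact (card S)" .
  qed
  have vanish: "c \<in> C \<longleftrightarrow> (\<forall>j\<in>S. \<Delta> c j = 0)" if "c \<in> Q" for c
  proof
    assume "c \<in> C"
    show "\<forall>j\<in>S. \<Delta> c j = 0"
    proof (intro ballI, rule ccontr)
      fix j assume "j \<in> S" "\<Delta> c j \<noteq> 0"
      then have "P (Suc r)"
        unfolding P_def \<Delta>_def using bj \<open>c \<in> C\<close>
        by (intro exI[of _ "bs @ [c]"] exI[of _ "js @ [j]"]) auto
      with notP show False ..
    qed
  next
    assume 0: "\<forall>j\<in>S. \<Delta> c j = 0"
    obtain \<gamma> where \<gamma>: "\<And>j. \<Delta> c j = minor bs js * c j + (\<Sum>a<length bs. \<gamma> a * (bs ! a) j)"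
      using minor_expand_last_column[of bs js c] bj unfolding \<Delta>_def by metis
    have "0 = (\<Sum>j\<in>S. \<Delta> c j * x j)" using 0 by simp
    also have "\<dots> = minor bs js * (\<Sum>j\<in>S. c j * x j) +
        (\<Sum>a<length bs. \<gamma> a * (\<Sum>j\<in>S. (bs ! a) j * x j))"
      unfolding \<gamma> distrib_right sum.distrib sum_distrib_left sum_distrib_right
      by (subst (2) sum.swap) (simp add: mult.assoc)
    finally have "minor bs js * (\<Sum>j\<in>S. c j * x j) =
        - (\<Sum>a<length bs. \<gamma> a * (\<Sum>j\<in>S. (bs ! a) j * x j))" by linarith
    moreover have "int m dvd (\<Sum>j\<in>S. (bs ! a) j * x j)" if "a < length bs" for a
      using bj(3) nth_mem[OF that] unfolding C_def by blast
    ultimately have "int m dvd minor bs js * (\<Sum>j\<in>S. c j * x j)"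
      by (auto intro!: dvd_sum)
    then show "c \<in> C"
      using cop that by (simp add: C_def coprime_commute coprime_dvd_mult_right_iff)
  qed
  have "\<forall>j\<in>S. \<exists>w. \<forall>c. \<Delta> c j = (\<Sum>s\<in>S. c s * w s)"
    using bordered_minor_functional[OF S _ bj(4)] bj unfolding \<Delta>_def by metis
  then obtain w where w: "\<And>c j. j \<in> S \<Longrightarrow> \<Delta> c j = (\<Sum>s\<in>S. c s * w j s)" by metis
  obtain u where u: "\<And>f. f \<in> \<Delta> ` Q \<Longrightarrow> (\<Sum>j\<in>S. u j * f j) = 0 \<Longrightarrow> \<forall>j\<in>S. f j = 0"
    using generic_combination[OF S finite_imageI[OF \<open>finite Q\<close>]] by blast
  define v where "v s = (\<Sum>j\<in>S. u j * w j s)" for s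
  show ?thesis
  proof (rule that[of v])
    fix c :: "'a \<Rightarrow> int" assume c: "\<And>s. s \<in> S \<Longrightarrow> \<bar>c s\<bar> \<le> 1"
    define c' where "c' = restrict c S"
    have c': "c' \<in> Q" using c unfolding c'_def Q_def by (fastforce simp: abs_le_iff)
    have "(\<Sum>s\<in>S. c s * v s) = (\<Sum>s\<in>S. c' s * v s)" by (simp add: c'_def)
    also have "\<dots> = (\<Sum>j\<in>S. u j * \<Delta> c' j)"
      unfolding v_def sum_distrib_left
      by (subst sum.swap) (simp add: w sum_distrib_left mult.left_commute cong: sum.cong)
    finally have "(\<Sum>s\<in>S. c s * v s) = 0 \<longleftrightarrow> (\<forall>j\<in>S. \<Delta> c' j = 0)"
      using u c' by auto
    also have "\<dots> \<longleftrightarrow> c' \<in> C" using vanish[OF c'] by blast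
    also have "\<dots> \<longleftrightarrow> int m dvd (\<Sum>s\<in>S. c s * x s)"
      using c' by (simp add: C_def c'_def)
    finally show "(\<Sum>s\<in>S. c s * v s) = 0 \<longleftrightarrow> int m dvd (\<Sum>s\<in>S. c s * x s)" .
  qed
qed



section \<open>Orderings of integers without zero segments\<close>

lemma sum_prefix_up_down_pos:
  fixes v :: "'a \<Rightarrow> int"
  assumes "\<And>p. p \<in> set ps \<Longrightarrow> v p > 0" "\<And>n. n \<in> set ns \<Longrightarrow> v n < 0"
    and "sum_list (map v (ps @ ns)) > 0" "prefix zs (ps @ ns)" "zs \<noteq> []"
  shows "sum_list (map v zs) > 0"
  using assms(4) unfolding prefix_append
proof
  assume "prefix zs ps"
  then have "set zs \<subseteq> set ps" by (rule set_mono_prefix)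
  with \<open>zs \<noteq> []\<close> show ?thesis
  proof (induction zs rule: list_nonempty_induct)
    case (cons y ys)
    then show ?case using assms(1)[of y] by simp
  qed (use assms(1) in simp)
next
  assume "\<exists>us. zs = ps @ us \<and> prefix us ns"
  then obtain us ws where us: "zs = ps @ us" "ns = us @ ws" by (auto elim: prefixE)
  have "sum_list (map v ws) \<le> 0"
    using assms(2) by (intro sum_list_nonpos) (auto simp: us less_imp_le)
  with assms(3) us show ?thesis by simp
qed

text \<open>
  Induction on the number of elements. With a positive total, a segment that starts with the first
  element is a prefix of an up-down sequence ending above its start and so has a positive sum;
  every other segment is covered by the induction hypothesis, which needs that the remaining total is
  nonzero or that nothing remains. As \<open>v\<close> is injective, at most one positive element leaves
  the total zero; if it is the only positive element, then the negative ones have sum zero and so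
  do not exist.
  Reversing the list and negating \<open>v\<close> exchanges the two signs of the total.
\<close>

lemma exists_up_down_ordering:
  fixes v :: "'a \<Rightarrow> int"
  assumes "finite P" "finite N" "inj_on v (P \<union> N)"
    and "\<And>p. p \<in> P \<Longrightarrow> v p > 0" "\<And>n. n \<in> N \<Longrightarrow> v n < 0"
    and "sum v P + sum v N \<noteq> 0 \<or> P \<union> N = {}"
  shows "\<exists>ps ns. distinct ps \<and> set ps = P \<and> distinct ns \<and> set ns = N \<and>
    (\<forall>zs. sublist zs (ps @ ns) \<longrightarrow> zs \<noteq> [] \<longrightarrow> sum_list (map v zs) \<noteq> 0)"
  using assms
proof (induction "card P + card N" arbitrary: P N v rule: less_induct)
  case less
  have step: "\<exists>ps ns. distinct ps \<and> set ps = P' \<and> distinct ns \<and> set ns = N' \<and>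
      (\<forall>zs. sublist zs (ps @ ns) \<longrightarrow> zs \<noteq> [] \<longrightarrow> sum_list (map v' zs) \<noteq> 0)"
    if size: "card P' + card N' = card P + card N" and fin: "finite P'" "finite N'"
      and inj: "inj_on v' (P' \<union> N')"
      and pos: "\<And>p. p \<in> P' \<Longrightarrow> v' p > 0" and neg: "\<And>n. n \<in> N' \<Longrightarrow> v' n < 0"
      and T: "sum v' P' + sum v' N' > 0"
    for P' N' and v' :: "'a \<Rightarrow> int"
  proof -
    have "sum v' N' \<le> 0" using neg by (intro sum_nonpos) (simp add: less_imp_le)
    with T have "P' \<noteq> {}" by auto
    obtain p where p: "p \<in> P'"
      "sum v' (P' - {p}) + sum v' N' \<noteq> 0 \<or> (P' - {p}) \<union> N' = {}"
    proof (cases "\<exists>p\<in>P'. sum v' P' + sum v' N' \<noteq> v' p")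
      case True
      then show ?thesis using that fin by (auto simp: sum_diff1)
    next
      case False
      obtain q where "q \<in> P'" using \<open>P' \<noteq> {}\<close> by blast
      have "s = q" if "s \<in> P'" for s
      proof -
        have "v' s = v' q" using False that \<open>q \<in> P'\<close> by metis
        then show ?thesis using inj_onD[OF inj, of s q] that \<open>q \<in> P'\<close> by blast
      qed
      with \<open>q \<in> P'\<close> have "P' = {q}" by blast
      with False have "sum v' N' = 0" by simp
      then have "N' = {}"
        using sum_strict_mono[of N' v' "\<lambda>_. 0"] fin neg by fastforce
      with \<open>P' = {q}\<close> that show ?thesis by blast
    qed
    have "\<exists>ps ns. distinct ps \<and> set ps = P' - {p} \<and> distinct ns \<and> set ns = N' \<and>
      (\<forall>zs. sublist zs (ps @ ns) \<longrightarrow> zs \<noteq> [] \<longrightarrow> sum_list (map v' zs) \<noteq> 0)"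
    proof (rule less.hyps)
      have "card P' > 0" using p fin card_gt_0_iff by blast
      then show "card (P' - {p}) + card N' < card P + card N"
        using size p fin by simp
      show "inj_on v' (P' - {p} \<union> N')" using inj by (rule inj_on_subset) auto
    qed (use fin pos neg p in auto)
    then obtain ps ns where l: "distinct ps" "set ps = P' - {p}" "distinct ns" "set ns = N'"
      and ok: "\<And>zs. sublist zs (ps @ ns) \<Longrightarrow> zs \<noteq> [] \<Longrightarrow> sum_list (map v' zs) \<noteq> 0" by blast
    have set: "set (p # ps) = P'" using l p by auto
    have dist: "distinct (p # ps)" using l by simp
    have "sum_list (map v' ((p # ps) @ ns)) = sum v' P' + sum v' N'"
      using sum_list_distinct_conv_sum_set[OF dist, of v']
        sum_list_distinct_conv_sum_set[OF l(3), of v'] set l by simp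
    then have T': "sum_list (map v' ((p # ps) @ ns)) > 0" using T by simp
    have "sum_list (map v' zs) \<noteq> 0" if "sublist zs ((p # ps) @ ns)" "zs \<noteq> []" for zs
    proof -
      from that(1) consider "prefix zs ((p # ps) @ ns)" | "sublist zs (ps @ ns)"
        by (auto simp: sublist_Cons_right)
      then show ?thesis
      proof cases
        case 1
        have "sum_list (map v' zs) > 0"
          by (rule sum_prefix_up_down_pos[OF _ _ T' 1 that(2)]) (use set l pos neg in auto)
        then show ?thesis by simp
      next
        case 2
        then show ?thesis using ok that(2) by blast
      qed
    qed
    then show ?thesis using set dist l by blast
  qed
  consider "sum v P + sum v N > 0" | "sum v P + sum v N < 0" | "P \<union> N = {}"
    using less.prems(6) by linarith
  then show ?case
  proof cases
    case 1
    then show ?thesis using step[of P N v] less.prems by blast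
  next
    case 2
    have "\<exists>ps ns. distinct ps \<and> set ps = N \<and> distinct ns \<and> set ns = P \<and>
      (\<forall>zs. sublist zs (ps @ ns) \<longrightarrow> zs \<noteq> [] \<longrightarrow> sum_list (map (\<lambda>y. - v y) zs) \<noteq> 0)"
    proof (rule step)
      show "inj_on (\<lambda>y. - v y) (N \<union> P)"
        using less.prems(3) by (simp add: inj_on_def Un_commute)
    qed (use less.prems 2 in \<open>auto simp: sum_negf\<close>)
    then obtain ps ns where l: "distinct ps" "set ps = N" "distinct ns" "set ns = P"
      and ok: "\<And>zs. sublist zs (ps @ ns) \<Longrightarrow> zs \<noteq> [] \<Longrightarrow> sum_list (map (\<lambda>y. - v y) zs) \<noteq> 0"
      by blast
    have "sum_list (map v zs) \<noteq> 0" if "sublist zs (rev ns @ rev ps)" "zs \<noteq> []" for zs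
    proof -
      have "sublist (rev zs) (ps @ ns)"
        using that(1) by (metis rev_append rev_rev_ident sublist_rev)
      from ok[OF this] that(2) show ?thesis
        by (simp add: rev_map[symmetric] uminus_sum_list_map[symmetric, unfolded o_def])
    qed
    then show ?thesis using l by (intro exI[of _ "rev ns"] exI[of _ "rev ps"]) auto
  next
    case 3
    then show ?thesis by auto
  qed
qed

text \<open>
  If the total is zero, removing one positive element makes it nonzero. A zero segment must then
  begin with that element in front, and what follows it is again a segment with sum zero and
  therefore empty: the zero segment is the whole list.
\<close>

lemma exists_ordering_no_zero_segment:
  fixes v :: "'a \<Rightarrow> int"
  assumes "finite S" "inj_on v S" "\<And>s. s \<in> S \<Longrightarrow> v s \<noteq> 0"
  shows "\<exists>xs. distinct xs \<and> set xs = S \<and>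
    (\<forall>zs. sublist zs xs \<longrightarrow> zs \<noteq> [] \<longrightarrow> sum_list (map v zs) = 0 \<longrightarrow> zs = xs)"
proof -
  define P N where "P = {s \<in> S. v s > 0}" and "N = {s \<in> S. v s < 0}"
  have PN: "finite P" "finite N" "P \<union> N = S" "P \<inter> N = {}"
    "\<And>p. p \<in> P \<Longrightarrow> v p > 0" "\<And>n. n \<in> N \<Longrightarrow> v n < 0"
    using assms by (auto simp: P_def N_def) (metis linorder_neqE)
  show ?thesis
  proof (cases "sum v P + sum v N \<noteq> 0 \<or> P \<union> N = {}")
    case True
    have "inj_on v (P \<union> N)" using assms PN by simp
    then obtain ps ns where l: "distinct ps" "set ps = P" "distinct ns" "set ns = N"
      and ok: "\<And>zs. sublist zs (ps @ ns) \<Longrightarrow> zs \<noteq> [] \<Longrightarrow> sum_list (map v zs) \<noteq> 0"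
      using exists_up_down_ordering[OF PN(1,2) _ PN(5,6) True] by blast
    show ?thesis
      using l ok PN by (intro exI[of _ "ps @ ns"]) auto
  next
    case False
    then have "P \<noteq> {}"
      using sum_strict_mono[of N v "\<lambda>_. 0"] PN by fastforce
    then obtain p where p: "p \<in> P" by blast
    have "inj_on v ((P - {p}) \<union> N)" using assms(2) by (rule inj_on_subset) (use PN in auto)
    moreover have "sum v (P - {p}) + sum v N \<noteq> 0 \<or> (P - {p}) \<union> N = {}"
      using False p PN(1) PN(5)[OF p] by (simp add: sum_diff1)
    ultimately obtain ps ns where l: "distinct ps" "set ps = P - {p}" "distinct ns" "set ns = N"
      and ok: "\<And>zs. sublist zs (ps @ ns) \<Longrightarrow> zs \<noteq> [] \<Longrightarrow> sum_list (map v zs) \<noteq> 0"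
      using exists_up_down_ordering[of "P - {p}" N v] PN by blast
    let ?xs = "p # ps @ ns"
    have xs: "distinct ?xs" "set ?xs = S" using l p PN by auto
    have "sum_list (map v ?xs) = sum v S"
      using sum_list_distinct_conv_sum_set[OF xs(1), of v] xs(2) by simp
    also have "\<dots> = sum v P + sum v N"
      using sum.union_disjoint[OF PN(1,2,4), of v] PN(3) by simp
    finally have 0: "sum_list (map v ?xs) = 0" using False by simp
    have "zs = ?xs" if "sublist zs ?xs" "zs \<noteq> []" "sum_list (map v zs) = 0" for zs
    proof -
      have "prefix zs ?xs" using that ok by (auto simp: sublist_Cons_right)
      then obtain ws where ws: "?xs = zs @ ws" by (auto elim: prefixE)
      with 0 that(3) have "sum_list (map v ws) = 0" by (metis add_0 map_append sum_list.append)
      moreover have "sublist ws (ps @ ns)"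
        using ws that(2) by (cases zs) (auto simp: sublist_def, metis append_Nil2)
      ultimately have "ws = []" using ok by blast
      with ws show ?thesis by simp
    qed
    then show ?thesis using xs by blast
  qed
qed

section \<open>Alternating sums and monotone walks\<close>

primrec alternating_sum :: "('a \<Rightarrow> bool) \<Rightarrow> ('a \<Rightarrow> int) \<Rightarrow> 'a list \<Rightarrow> int" where
  "alternating_sum R f [] = 0"
| "alternating_sum R f (y # ys) =
    f y + (if R y then - alternating_sum R f ys else alternating_sum R f ys)"

text \<open>
  \<open>e\<close> is the sign that the walk has reached before the list is read; each element contributes its value
  with the current sign, and this contribution has to be positive.
\<close>

primrec well_signed :: "('a \<Rightarrow> bool) \<Rightarrow> ('a \<Rightarrow> int) \<Rightarrow> int \<Rightarrow> 'a list \<Rightarrow> bool" where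
  "well_signed R f e [] \<longleftrightarrow> True"
| "well_signed R f e (y # ys) \<longleftrightarrow> e * f y > 0 \<and> well_signed R f (if R y then - e else e) ys"

lemma well_signed_alternating_sum_pos:
  assumes "well_signed R f e zs" "zs \<noteq> []"
  shows "e * alternating_sum R f zs > 0"
  using assms
proof (induction zs arbitrary: e)
  case (Cons y ys)
  let ?e = "if R y then - e else e"
  have "?e * alternating_sum R f ys \<ge> 0"
    using Cons by (cases "ys = []") (auto simp: less_imp_le)
  then show ?case using Cons.prems by (auto simp: algebra_simps split: if_splits)
qed simp

lemma well_signed_sublist:
  assumes "well_signed R f e xs" "sublist zs xs"
  obtains e' where "well_signed R f e' zs"
proof -
  from assms(2) obtain us ws where "xs = us @ zs @ ws" by (auto simp: sublist_def)
  with assms(1) have "well_signed R f e (us @ zs @ ws)" by simp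
  then have "\<exists>e'. well_signed R f e' (zs @ ws)"
    by (induction us arbitrary: e) auto
  then obtain e' where "well_signed R f e' (zs @ ws)" ..
  then have "well_signed R f e' zs"
    by (induction zs arbitrary: e') auto
  then show ?thesis by (rule that)
qed

lemma well_signed_append_nonreflection:
  assumes "\<And>y. y \<in> set us \<Longrightarrow> \<not> R y \<and> e * f y > 0"
  shows "well_signed R f e (us @ ys) \<longleftrightarrow> well_signed R f e ys"
  using assms by (induction us) auto

text \<open>
  When the elements used are all reflections, the sign flips at every step. After one element of
  \<open>H\<close> the same problem arises with the two sets exchanged and the opposite sign.
\<close>

lemma exists_alternating_ordering:
  assumes "finite H" "finite L" "H \<inter> L = {}" "card H = card L \<or> card H = Suc (card L)"
    and "\<And>h. h \<in> H \<Longrightarrow> R h \<and> e * f h > 0" "\<And>l. l \<in> L \<Longrightarrow> R l \<and> e * f l < 0"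
  shows "\<exists>xs. distinct xs \<and> set xs = H \<union> L \<and> well_signed R f e xs"
  using assms
proof (induction "card H + card L" arbitrary: H L e rule: less_induct)
  case less
  show ?case
  proof (cases "H = {}")
    case True
    with less.prems have "L = {}" by auto
    with True show ?thesis by (intro exI[of _ "[]"]) simp
  next
    case False
    then obtain h where h: "h \<in> H" by blast
    have "card H > 0" using False less.prems by (simp add: card_gt_0_iff)
    have "\<exists>xs. distinct xs \<and> set xs = L \<union> (H - {h}) \<and> well_signed R f (- e) xs"
    proof (rule less.hyps)
      show "card L + card (H - {h}) < card H + card L"
        using \<open>card H > 0\<close> h by simp
      show "card L = card (H - {h}) \<or> card L = Suc (card (H - {h}))"
        using less.prems(4) \<open>card H > 0\<close> h by auto
    qed (use less.prems in auto)
    then obtain xs where "distinct xs" "set xs = L \<union> (H - {h})" "well_signed R f (- e) xs"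
      by blast
    with h less.prems show ?thesis by (intro exI[of _ "h # xs"]) auto
  qed
qed

text \<open>
  The positive rotations come before the first reflection, where the sign is \<open>1\<close>, and the negative
  ones right after it, where the sign is \<open>-1\<close>. This is where a reflection has to exist.
\<close>

lemma exists_well_signed_ordering:
  assumes "finite S" "\<And>s. s \<in> S \<Longrightarrow> f s \<noteq> 0" "\<exists>s\<in>S. R s"
    and "card {s \<in> S. R s \<and> f s > 0} = card {s \<in> S. R s \<and> f s < 0} \<or>
      card {s \<in> S. R s \<and> f s > 0} = Suc (card {s \<in> S. R s \<and> f s < 0})"
  shows "\<exists>xs. distinct xs \<and> set xs = S \<and> well_signed R f 1 xs"
proof -
  define H L where "H = {s \<in> S. R s \<and> f s > 0}" and "L = {s \<in> S. R s \<and> f s < 0}"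
  have "\<exists>ys. distinct ys \<and> set ys = H \<union> L \<and> well_signed R f 1 ys"
  proof (rule exists_alternating_ordering)
    show "card H = card L \<or> card H = Suc (card L)" using assms(4) unfolding H_def L_def .
  qed (use assms(1) in \<open>auto simp: H_def L_def\<close>)
  then obtain ys where ys: "distinct ys" "set ys = H \<union> L" "well_signed R f 1 ys" by blast
  have set_ys: "set ys = {s \<in> S. R s}"
    unfolding ys(2) H_def L_def using assms(2) by (auto simp: neq_iff)
  then have "ys \<noteq> []" using assms(3) by auto
  then obtain h zs where hz: "ys = h # zs" by (cases ys) auto
  have "R h" using set_ys hz by auto
  obtain ps where ps: "distinct ps" "set ps = {s \<in> S. \<not> R s \<and> f s > 0}"
    using finite_distinct_list[of "{s \<in> S. \<not> R s \<and> f s > 0}"] assms(1) by auto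
  obtain ns where ns: "distinct ns" "set ns = {s \<in> S. \<not> R s \<and> f s < 0}"
    using finite_distinct_list[of "{s \<in> S. \<not> R s \<and> f s < 0}"] assms(1) by auto
  have "well_signed R f 1 (ps @ h # ns @ zs)"
    using ys(3) \<open>R h\<close> ps ns well_signed_append_nonreflection[of ps R 1 f]
      well_signed_append_nonreflection[of ns R "-1" f] by (simp add: hz)
  moreover have "distinct (ps @ h # ns @ zs)"
    using ys(1) ps ns set_ys unfolding hz by auto
  moreover have "set (ps @ h # ns @ zs) = S"
  proof -
    have "set (ps @ h # ns @ zs) = set ps \<union> set ns \<union> set ys" by (auto simp: hz)
    then show ?thesis using assms(2) unfolding ps ns set_ys by (auto simp: neq_iff)
  qed
  ultimately show ?thesis by blast
qed

lemma exists_lower_part: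
  fixes v :: "'a \<Rightarrow> int"
  assumes "finite F" "inj_on v F" "t \<le> card F"
  shows "\<exists>L\<subseteq>F. card L = t \<and> (\<forall>l\<in>L. \<forall>h\<in>F - L. v l < v h)"
  using assms(3)
proof (induction t)
  case 0
  then show ?case by (intro exI[of _ "{}"]) auto
next
  case (Suc t)
  then obtain L where L: "L \<subseteq> F" "card L = t" "\<forall>l\<in>L. \<forall>h\<in>F - L. v l < v h" by auto
  have "F - L \<noteq> {}" using Suc.prems L by (metis Diff_eq_empty_iff Suc_n_not_le_n subset_antisym)
  then obtain q where q: "q \<in> F - L" "\<And>h. h \<in> F - L \<Longrightarrow> v q \<le> v h"
    using ex_min_if_finite[of "v ` (F - L)"] assms(1) by (auto simp: not_less)
  have "v q < v h" if "h \<in> F - insert q L" for h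
  proof -
    have "v q \<noteq> v h" using q(1) that inj_onD[OF assms(2), of q h] by auto
    with q(2)[of h] that show ?thesis by auto
  qed
  with L q show ?case
    using finite_subset[OF L(1) assms(1)] by (intro exI[of _ "insert q L"]) auto
qed

text \<open>
  Doubling the values leaves room for an odd threshold strictly between them. The surplus element of
  an odd set goes above it, since an alternating walk that starts with sign \<open>1\<close> uses a
  reflection above the threshold first.
\<close>

lemma exists_odd_median:
  fixes v :: "'a \<Rightarrow> int"
  assumes "finite F" "inj_on v F" "F \<noteq> {}"
  obtains \<tau> where "odd \<tau>"
    "card {s \<in> F. 2 * v s > \<tau>} = card {s \<in> F. 2 * v s < \<tau>} \<or>
     card {s \<in> F. 2 * v s > \<tau>} = Suc (card {s \<in> F. 2 * v s < \<tau>})"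
proof -
  obtain L where L: "L \<subseteq> F" "card L = card F div 2" "\<forall>l\<in>L. \<forall>h\<in>F - L. v l < v h"
    using exists_lower_part[OF assms(1,2), of "card F div 2"] by auto
  have "card F > 0" using assms by (simp add: card_gt_0_iff)
  then have "L \<noteq> F" using L by auto
  then have ne: "F - L \<noteq> {}" using L by auto
  define \<tau> where "\<tau> = 2 * Min (v ` (F - L)) - 1"
  have Mm: "Min (v ` (F - L)) \<in> v ` (F - L)" using ne assms by (intro Min_in) auto
  have hi: "2 * v s > \<tau>" if "s \<in> F - L" for s
  proof -
    have "Min (v ` (F - L)) \<le> v s" using that assms by (intro Min_le) auto
    then show ?thesis by (simp add: \<tau>_def)
  qed
  have lo: "2 * v s < \<tau>" if "s \<in> L" for s
  proof -
    have "v s < Min (v ` (F - L))" using Mm L that by auto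
    then show ?thesis by (simp add: \<tau>_def)
  qed
  have "{s \<in> F. 2 * v s > \<tau>} = F - L" "{s \<in> F. 2 * v s < \<tau>} = L"
    using hi lo L(1) by (auto dest: order.asym)
  moreover have "card (F - L) = card F - card F div 2"
    using L assms by (metis card_Diff_subset finite_subset)
  moreover have "odd \<tau>" by (simp add: \<tau>_def)
  moreover have "card F - card F div 2 = card F div 2 \<or>
      card F - card F div 2 = Suc (card F div 2)" by presburger
  ultimately show ?thesis using that[of \<tau>] L(2) by simp
qed

text \<open>
  Shifting the values of the reflections by \<open>\<tau>\<close> changes nothing in segments with an even number of
  reflections, because the shifts enter with alternating signs.
\<close>

lemma alternating_sum_shift:
  "alternating_sum R (\<lambda>s. if R s then 2 * v s - \<tau> else 2 * v s) zs =
    2 * alternating_sum R v zs - (if odd (length (filter R zs)) then \<tau> else 0)"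
  by (induction zs) auto

lemma alternating_sum_linear:
  assumes "distinct zs" "set zs \<subseteq> S" "finite S"
  shows "\<exists>c :: 'a \<Rightarrow> int. (\<forall>s. \<bar>c s\<bar> \<le> 1) \<and>
    (\<forall>f. alternating_sum R f zs = (\<Sum>s\<in>S. c s * f s))"
proof -
  have "\<exists>c :: 'a \<Rightarrow> int. (\<forall>s. \<bar>c s\<bar> \<le> 1) \<and>
      (\<forall>f. alternating_sum R f zs = (\<Sum>s\<in>set zs. c s * f s))"
    using assms(1)
  proof (induction zs)
    case Nil
    show ?case by (intro exI[of _ "\<lambda>_. 0"]) simp
  next
    case (Cons y zs)
    then obtain c :: "'a \<Rightarrow> int" where c: "\<And>s. \<bar>c s\<bar> \<le> 1"
      "\<And>f. alternating_sum R f zs = (\<Sum>s\<in>set zs. c s * f s)" by auto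
    let ?e = "if R y then -1 else 1 :: int"
    have "alternating_sum R f (y # zs) = (\<Sum>s\<in>set (y # zs). ((\<lambda>s. ?e * c s)(y := 1)) s * f s)" for f
    proof -
      have "(\<Sum>s\<in>set zs. ((\<lambda>s. ?e * c s)(y := 1)) s * f s) = (\<Sum>s\<in>set zs. ?e * (c s * f s))"
        using Cons.prems by (intro sum.cong) auto
      also have "\<dots> = ?e * alternating_sum R f zs" by (simp only: c(2) sum_distrib_left)
      finally show ?thesis using Cons.prems by simp
    qed
    moreover have "\<bar>((\<lambda>s. ?e * c s)(y := 1)) s\<bar> \<le> 1" for s using c(1)[of s] by simp
    ultimately show ?case by blast
  qed
  then obtain c :: "'a \<Rightarrow> int" where c: "\<And>s. \<bar>c s\<bar> \<le> 1"
    "\<And>f. alternating_sum R f zs = (\<Sum>s\<in>set zs. c s * f s)" by auto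
  have "(\<Sum>s\<in>set zs. c s * f s) = (\<Sum>s\<in>S. (if s \<in> set zs then c s else 0) * f s)" for f
    using assms by (intro sum.mono_neutral_cong_left) auto
  with c show ?thesis by (intro exI[of _ "\<lambda>s. if s \<in> set zs then c s else 0"]) auto
qed


section \<open>Products in dihedral groups\<close>

abbreviation reflection :: "int \<times> int \<Rightarrow> bool" where
  "reflection y \<equiv> snd y = 1"

lemma (in monoid) foldl_mult_eq:
  assumes "g \<in> carrier G" "set zs \<subseteq> carrier G"
  shows "foldl (\<otimes>) \<one> zs \<in> carrier G \<and> foldl (\<otimes>) g zs = g \<otimes> foldl (\<otimes>) \<one> zs"
  using assms
proof (induction zs arbitrary: g)
  case (Cons y zs)
  then have in_carrier: "y \<in> carrier G" "g \<otimes> y \<in> carrier G" "set zs \<subseteq> carrier G" by auto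
  note Cons.IH[OF in_carrier(1,3)] Cons.IH[OF in_carrier(2,3)]
  with Cons.prems(1) in_carrier show ?case by (simp add: m_assoc)
qed simp

lemma (in group) partial_sum_eq_imp_segment_product_one:
  assumes "set xs \<subseteq> carrier G" "i \<le> j" "partial_sum G xs i = partial_sum G xs j"
  shows "foldl (\<otimes>) \<one> (drop i (take j xs)) = \<one>"
proof -
  have sub: "set (take i xs) \<subseteq> carrier G" "set (drop i (take j xs)) \<subseteq> carrier G"
    using assms(1) by (meson set_take_subset set_drop_subset subset_trans)+
  have i: "partial_sum G xs i \<in> carrier G"
    unfolding partial_sum_def using foldl_mult_eq[OF one_closed sub(1)] by (rule conjunct1)
  have "take j xs = take i xs @ drop i (take j xs)"
    using assms(2) append_take_drop_id[of i "take j xs"] by (simp add: min_absorb1)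
  then have "partial_sum G xs j = foldl (\<otimes>) (partial_sum G xs i) (drop i (take j xs))"
    unfolding partial_sum_def by (subst foldl_append[symmetric]) (erule arg_cong)
  also have "\<dots> = partial_sum G xs i \<otimes> foldl (\<otimes>) \<one> (drop i (take j xs))"
    using foldl_mult_eq[OF i sub(2)] by (rule conjunct2)
  finally have "partial_sum G xs i = partial_sum G xs i \<otimes> foldl (\<otimes>) \<one> (drop i (take j xs))"
    using assms(3) by (rule trans[rotated])
  then show ?thesis
    using l_cancel_one'[OF i conjunct1[OF foldl_mult_eq[OF one_closed sub(2)]]] by (rule iffD1[rotated])
qed

lemma dihedral_product:
  assumes "set zs \<subseteq> carrier (dihedral_group m)"
  shows "foldl (\<otimes>\<^bsub>dihedral_group m\<^esub>) \<one>\<^bsub>dihedral_group m\<^esub> zs =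
    (alternating_sum reflection fst zs mod int m, int (length (filter reflection zs)) mod 2)"
  using assms
proof (induction zs)
  case Nil
  then show ?case by (simp add: dihedral_group_def)
next
  case (Cons y zs)
  interpret group "dihedral_group m" by (rule group_dihedral_group)
  obtain r a where y: "y = (r, a)" by (cases y)
  have "a = 0 \<or> a = 1"
    using Cons.prems by (auto simp: y dihedral_group_def carrier_integer_mod_group)
  moreover have "foldl (\<otimes>\<^bsub>dihedral_group m\<^esub>) \<one>\<^bsub>dihedral_group m\<^esub> (y # zs) =
      y \<otimes>\<^bsub>dihedral_group m\<^esub> foldl (\<otimes>\<^bsub>dihedral_group m\<^esub>) \<one>\<^bsub>dihedral_group m\<^esub> zs"
    using foldl_mult_eq[of y zs] Cons.prems by simp
  moreover have "set zs \<subseteq> carrier (dihedral_group m)" using Cons.prems by simp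
  note Cons.IH[OF this]
  ultimately show ?case
    by (elim disjE) (simp_all add: y, simp_all add: dihedral_group_def mod_simps)
qed

text \<open>
  A segment of the ordering with trivial product is the same as a coincidence of two partial
  products. If only the whole list can be such a segment, the ordering is cyclic or linear
  according to whether it is one. The empty ordering counts as linear.
\<close>

lemma sequenceable_if_only_full_segment_trivial:
  assumes G: "group G" and xs: "distinct xs" "set xs = S" "S \<subseteq> carrier G"
    and seg: "\<And>zs. sublist zs xs \<Longrightarrow> zs \<noteq> [] \<Longrightarrow>
      foldl (\<otimes>\<^bsub>G\<^esub>) \<one>\<^bsub>G\<^esub> zs = \<one>\<^bsub>G\<^esub> \<Longrightarrow> zs = xs"
  shows "sequenceable G S"
proof -
  interpret group G by (rule G)
  have ord: "ordering_of S xs" using xs by (simp add: ordering_of_def)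
  have ends: "i = 0 \<and> j = length xs"
    if "i < j" "j \<le> length xs" "partial_sum G xs i = partial_sum G xs j" for i j
  proof -
    let ?zs = "drop i (take j xs)"
    have "sublist ?zs xs"
      by (rule sublist_order.order_trans[OF sublist_drop sublist_take])
    moreover have "?zs \<noteq> []" using that by simp
    moreover have "foldl (\<otimes>\<^bsub>G\<^esub>) \<one>\<^bsub>G\<^esub> ?zs = \<one>\<^bsub>G\<^esub>"
      using partial_sum_eq_imp_segment_product_one[of xs i j] that xs by simp
    ultimately have "?zs = xs" by (rule seg)
    then have "length ?zs = length xs" by simp
    with that show ?thesis by auto
  qed
  show ?thesis
  proof (cases "xs \<noteq> [] \<and> partial_sum G xs (length xs) = \<one>\<^bsub>G\<^esub>")
    case True
    have "cyclic_sequencing G S xs"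
      unfolding cyclic_sequencing_def
    proof (intro conjI ord allI impI notI)
      fix i j
      assume "i < j \<and> j \<le> length xs \<and> (i, j) \<noteq> (0, length xs)"
        "partial_sum G xs i = partial_sum G xs j"
      with ends[of i j] show False by simp
    qed (use True in \<open>simp_all add: partial_sum_def\<close>)
    then show ?thesis unfolding sequenceable_def by blast
  next
    case False
    have "linear_sequencing G S xs"
      unfolding linear_sequencing_def
    proof (intro conjI ord allI impI notI)
      fix i j assume "i < j \<and> j \<le> length xs" "partial_sum G xs i = partial_sum G xs j"
      with ends[of i j] have "i = 0" "j = length xs" "xs \<noteq> []"
        "partial_sum G xs 0 = partial_sum G xs (length xs)" by auto
      with False show False by (simp add: partial_sum_def)
    qed
    then show ?thesis unfolding sequenceable_def by blast
  qed
qed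

theorem theorem3p17:
  fixes k m :: nat and S :: "(int \<times> int) set"
  assumes "k \<le> 12"
    and "m > 0"
    and "\<And>p :: nat. prime p \<Longrightarrow> p dvd m \<Longrightarrow> p > fact k"
    and "S \<subseteq> carrier (dihedral_group m) - {\<one>\<^bsub>dihedral_group m\<^esub>}"
    and "finite S"
    and "card S = k"
  shows "sequenceable (dihedral_group m) S"
proof -
  let ?G = "dihedral_group m" and ?R = reflection
  have SG: "S \<subseteq> carrier ?G" using assms(4) by blast
  have coords: "0 \<le> fst s \<and> fst s < int m \<and> (snd s = 0 \<or> snd s = 1) \<and> s \<noteq> (0, 0)"
    if "s \<in> S" for s
    using that assms(2,4) by (auto simp: dihedral_group_def carrier_integer_mod_group)
  obtain v :: "int \<times> int \<Rightarrow> int" where v: "\<And>c. (\<And>s. s \<in> S \<Longrightarrow> \<bar>c s\<bar> \<le> 1) \<Longrightarrow>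
      (\<Sum>s\<in>S. c s * v s) = 0 \<longleftrightarrow> int m dvd (\<Sum>s\<in>S. c s * fst s)"
    using rectification[OF assms(5,2), of fst] assms(3,6) by blast
  \<comment> \<open>the forms with coefficients \<open>1, -1\<close> on two elements and \<open>1\<close> on one element carry over
    distinctness and nontriviality from the residues to \<open>v\<close>\<close>
  have inj: "s = t" if "s \<in> S" "t \<in> S" "v s = v t" "snd s = snd t" for s t
  proof (rule ccontr)
    assume "s \<noteq> t"
    define c :: "int \<times> int \<Rightarrow> int" where
      "c r = (if r = s then 1 else 0) - (if r = t then 1 else 0)" for r
    have c: "(\<Sum>r\<in>S. c r * f r) = f s - f t" for f
    proof -
      have "(\<Sum>r\<in>S. c r * f r) = (\<Sum>r\<in>S. (if r = s then f r else 0) - (if r = t then f r else 0))"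
        by (rule sum.cong) (auto simp: c_def)
      then show ?thesis
        using that(1,2) assms(5) by (simp add: sum_subtractf sum.delta)
    qed
    have "\<bar>c r\<bar> \<le> 1" for r by (simp add: c_def)
    then have "int m dvd fst s - fst t"
      using v[of c] that(3) unfolding c by simp
    moreover have "\<bar>fst s - fst t\<bar> < int m" using coords[OF that(1)] coords[OF that(2)] by linarith
    ultimately have "fst s = fst t" using dvd_imp_le_int[of "fst s - fst t" "int m"] by linarith
    with \<open>s \<noteq> t\<close> that(4) show False by (simp add: prod_eq_iff)
  qed
  have nonzero: "v s \<noteq> 0" if "s \<in> S" "\<not> ?R s" for s
  proof
    assume "v s = 0"
    define c :: "int \<times> int \<Rightarrow> int" where "c r = (if r = s then 1 else 0)" for r
    have c: "(\<Sum>r\<in>S. c r * f r) = f s" for f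
    proof -
      have "(\<Sum>r\<in>S. c r * f r) = (\<Sum>r\<in>S. if r = s then f r else 0)"
        by (rule sum.cong) (auto simp: c_def)
      then show ?thesis using that(1) assms(5) by (simp add: sum.delta)
    qed
    have "\<bar>c r\<bar> \<le> 1" for r by (simp add: c_def)
    then have "int m dvd fst s"
      using v[of c] \<open>v s = 0\<close> unfolding c by simp
    moreover have "0 \<le> fst s" "fst s < int m" using coords[OF that(1)] by auto
    ultimately have "fst s = 0" using zdvd_imp_le[of "int m" "fst s"] by linarith
    with coords[OF that(1)] that(2) show False by (cases s) auto
  qed
  \<comment> \<open>conversely, a coincidence of partial products in the group is one in the infinite
    dihedral group with the coordinates \<open>v\<close>\<close>
  have lift: "alternating_sum ?R v zs = 0 \<and> even (length (filter ?R zs))"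
    if "distinct xs" "set xs = S" "sublist zs xs"
      "foldl (\<otimes>\<^bsub>?G\<^esub>) \<one>\<^bsub>?G\<^esub> zs = \<one>\<^bsub>?G\<^esub>" for zs xs
  proof -
    have zs: "distinct zs" "set zs \<subseteq> S"
      using that by (auto simp: sublist_def)
    obtain c where c: "\<And>s. \<bar>c s\<bar> \<le> 1" "\<And>f. alternating_sum ?R f zs = (\<Sum>s\<in>S. c s * f s)"
      using alternating_sum_linear[OF zs assms(5)] by metis
    have "set zs \<subseteq> carrier ?G" using zs SG by blast
    from dihedral_product[OF this] that(4)
    have "alternating_sum ?R fst zs mod int m = 0" "int (length (filter ?R zs)) mod 2 = 0"
      by (simp_all add: dihedral_group_def)
    then show ?thesis
      using v[of c] c by (auto simp: mod_eq_0_iff_dvd)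
  qed
  show ?thesis
  proof (cases "\<exists>s\<in>S. ?R s")
    case False
    have "inj_on v S"
      using inj coords False by (intro inj_onI) metis
    then obtain xs where xs: "distinct xs" "set xs = S"
      "\<And>zs. sublist zs xs \<Longrightarrow> zs \<noteq> [] \<Longrightarrow> sum_list (map v zs) = 0 \<Longrightarrow> zs = xs"
      using exists_ordering_no_zero_segment[OF assms(5), of v] nonzero False by blast
    show ?thesis
    proof (rule sequenceable_if_only_full_segment_trivial[OF group_dihedral_group xs(1,2) SG])
      fix zs assume zs: "sublist zs xs" "zs \<noteq> []" "foldl (\<otimes>\<^bsub>?G\<^esub>) \<one>\<^bsub>?G\<^esub> zs = \<one>\<^bsub>?G\<^esub>"
      have "\<forall>s\<in>set zs. \<not> ?R s" using False xs(2) zs(1) by (auto simp: sublist_def)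
      then have "alternating_sum ?R v zs = sum_list (map v zs)" by (induction zs) auto
      then have "sum_list (map v zs) = 0" using lift[OF xs(1,2) zs(1,3)] by simp
      with zs show "zs = xs" by (intro xs(3))
    qed
  next
    case True
    let ?F = "{s \<in> S. ?R s}"
    have F: "finite ?F" "inj_on v ?F" "?F \<noteq> {}"
      using assms(5) True inj by (simp, intro inj_onI, auto)
    obtain \<tau> where \<tau>: "odd \<tau>"
      "card {s \<in> ?F. 2 * v s > \<tau>} = card {s \<in> ?F. 2 * v s < \<tau>} \<or>
       card {s \<in> ?F. 2 * v s > \<tau>} = Suc (card {s \<in> ?F. 2 * v s < \<tau>})"
      using exists_odd_median[OF F] by blast
    \<comment> \<open>\<open>h\<close> is the increase, up to the current sign, of twice the position lowered by \<open>\<tau>/2\<close>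
      in the reversed orientation\<close>
    define h where "h = (\<lambda>s. if ?R s then 2 * v s - \<tau> else 2 * v s)"
    have sides: "{s \<in> ?F. 2 * v s > \<tau>} = {s \<in> S. ?R s \<and> h s > 0}"
      "{s \<in> ?F. 2 * v s < \<tau>} = {s \<in> S. ?R s \<and> h s < 0}"
      by (auto simp: h_def)
    have "h s \<noteq> 0" if "s \<in> S" for s
      using nonzero[OF that] \<tau>(1) by (auto simp: h_def)
    then obtain xs where xs: "distinct xs" "set xs = S" "well_signed ?R h 1 xs"
      using exists_well_signed_ordering[OF assms(5) _ True \<tau>(2)[unfolded sides]] by blast
    show ?thesis
    proof (rule sequenceable_if_only_full_segment_trivial[OF group_dihedral_group xs(1,2) SG])
      fix zs assume zs: "sublist zs xs" "zs \<noteq> []" "foldl (\<otimes>\<^bsub>?G\<^esub>) \<one>\<^bsub>?G\<^esub> zs = \<one>\<^bsub>?G\<^esub>"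
      have "alternating_sum ?R h zs = 0"
        using lift[OF xs(1,2) zs(1,3)] by (simp add: h_def alternating_sum_shift)
      moreover obtain e where "well_signed ?R h e zs"
        using well_signed_sublist[OF xs(3) zs(1)] .
      ultimately show "zs = xs"
        using well_signed_alternating_sum_pos[of ?R h e zs] zs(2) by simp
    qed
  qed
qed

end
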